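(* Let $X$ and $Y$ be real linear spaces, let $D$ be an arbitrary set and let $f\colon D\to X$ and $g\colon D\to Y$ be admissible functions. Then $\mathscr{B}_f=\mathscr{B}_g$ (as functions on $\mathscr{W}(D)$) if and only if $g=A\circ f$ for some linear map $A\colon X\to Y$.
   Context: Notation: $\mathbb{R}_+=(0,+\infty)$; $W_n=[0,+\infty)^n\setminus\{(0,\dots,0)\}$; $\mathscr{W}(D)=\bigcup_{n=1}^\infty D^n\times W_n$. Admissible functions and generalized Bajraktarević means: For a nonzero $x$ in a real linear space $X$, the ray generated by $x$ is $R_x=\{\lambda x\mid\lambda\in\mathbb{R}_+\}$. For $S\subseteq X$, $\operatorname{cone}(S)=\{\lambda x\mid \lambda\in\mathbb{R}_+,\ x\in S\}$. The set $S$ is observable if the rays generated by any two distinct elements of $S$ are disjoint, and conically convex if $\operatorname{cone}(S)$ is convex and $0\notin\operatorname{conv}(S)$. A function $f\colon D\to X$ is admissible if it is injective and $f(D)$ is observable and conically convex. For such $f$, $\pi_f\colon\operatorname{cone}(f(D))\to f(D)$ maps $y$ to the unique point $x\in f(D)$ with $y\in R_x$, and $f^{(-1)}:=f^{-1}\circ\pi_f\colon\operatorname{cone}(f(D))\to D$. For $(x,\lambda)\in D^n\times W_n$ put $\mathscr{B}_f(x,\lambda)=f^{(-1)}\big(\sum_{k=1}^n\lambda_kf(x_k)\big)\in D$. *)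

theory Defs
  imports "HOL-Analysis.Convex"
begin

(* The ray of a vector is meaningful only for x \<noteq> 0. Every set it is applied to below is
   conically convex and hence does not contain 0. *)
definition ray :: "'a::real_vector \<Rightarrow> 'a set" where
  "ray x = {t *\<^sub>R x | t. t > 0}"

(* Open cone, consisting of the strictly positive multiples only. It differs from the library's
   conic hull, where the factor 0 is allowed. *)
definition gen_cone :: "'a::real_vector set \<Rightarrow> 'a set" where
  "gen_cone S = {t *\<^sub>R x | t x. t > 0 \<and> x \<in> S}"

definition observable :: "'a::real_vector set \<Rightarrow> bool" where
  "observable S \<longleftrightarrow> (\<forall>x\<in>S. \<forall>y\<in>S. x \<noteq> y \<longrightarrow> ray x \<inter> ray y = {})"

definition conically_convex :: "'a::real_vector set \<Rightarrow> bool" where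
  "conically_convex S \<longleftrightarrow> convex (gen_cone S) \<and> 0 \<notin> convex hull S"

definition admissible :: "'d set \<Rightarrow> ('d \<Rightarrow> 'a::real_vector) \<Rightarrow> bool" where
  "admissible D f \<longleftrightarrow> inj_on f D \<and> observable (f ` D) \<and> conically_convex (f ` D)"

(* For admissible f, the point is uniquely determined when y lies in gen_cone (f ` D);
   elsewhere the value is unspecified. The same holds for gen_inv. *)
definition ray_proj :: "'d set \<Rightarrow> ('d \<Rightarrow> 'a::real_vector) \<Rightarrow> 'a \<Rightarrow> 'a" where
  "ray_proj D f y = (THE x. x \<in> f ` D \<and> y \<in> ray x)"

definition gen_inv :: "'d set \<Rightarrow> ('d \<Rightarrow> 'a::real_vector) \<Rightarrow> 'a \<Rightarrow> 'd" where
  "gen_inv D f = inv_into D f \<circ> ray_proj D f"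

(* Tuples of length n are lists of length n; list positions are counted from 0. *)
definition weights :: "nat \<Rightarrow> real list set" where
  "weights n = {l. length l = n \<and> (\<forall>t\<in>set l. t \<ge> 0) \<and> l \<noteq> replicate n 0}"

definition weighted_tuples :: "'d set \<Rightarrow> ('d list \<times> real list) set" where
  "weighted_tuples D = (\<Union>n\<in>{1..}. {x. length x = n \<and> set x \<subseteq> D} \<times> weights n)"

definition baj_mean :: "'d set \<Rightarrow> ('d \<Rightarrow> 'a::real_vector) \<Rightarrow> 'd list \<times> real list \<Rightarrow> 'd" where
  "baj_mean D f = (\<lambda>(x, l). gen_inv D f (\<Sum>k<length x. l ! k *\<^sub>R f (x ! k)))"

end

theory Submission
  imports Defs
begin

text \<open>
  A mean of \<open>f\<close> is the point \<open>u\<close> for which the weighted sum of the values of \<open>f\<close> lies on the ray of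
  \<open>f u\<close>. A linear map sends rays to rays, so composing \<open>f\<close> with it does not move the means.

  Conversely, let the means agree. Whenever \<open>\<Sum>\<^sub>i \<lambda>\<^sub>i f(x\<^sub>i) = t f(u)\<close> with \<open>t > 0\<close>, equality of the means
  only gives \<open>\<Sum>\<^sub>i \<lambda>\<^sub>i g(x\<^sub>i) = s g(u)\<close> for some \<open>s > 0\<close>; the point is that \<open>s = t\<close>
  (\<open>equal_means_transfer_point\<close>). To see this, add a further point \<open>v \<noteq> u\<close> of weight \<open>1\<close>. On the side
  of \<open>f\<close>, the enlarged tuple and the pair \<open>(v, u)\<close> with weights \<open>(1, t)\<close> have the same weighted sum,
  hence the same mean. So \<open>s g(u) + g(v)\<close> and \<open>t g(u) + g(v)\<close> lie on one ray, and as \<open>g(u)\<close> and \<open>g(v)\<close>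
  are linearly independent, \<open>s = t\<close>.

  Splitting the coefficients of a linear relation into positive and negative parts then shows that
  every linear relation among values of \<open>f\<close> also holds among the values of \<open>g\<close>
  (\<open>equal_means_transfer_relation\<close>). Therefore the assignment \<open>f x \<mapsto> g x\<close>, made on a basis of
  the span of \<open>f ` D\<close> that is chosen among the values of \<open>f\<close>, extends to a linear map that is correct on all of \<open>f ` D\<close>.
\<close>

section \<open>Values of admissible functions\<close>

lemma gen_coneI: "t > 0 \<Longrightarrow> x \<in> S \<Longrightarrow> t *\<^sub>R x \<in> gen_cone S"
  unfolding gen_cone_def by blast

lemma zero_notin_gen_cone:
  assumes "conically_convex S"
  shows "0 \<notin> gen_cone S"
proof
  assume "0 \<in> gen_cone S"
  then have "0 \<in> S"
    by (auto simp: gen_cone_def)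
  then show False
    using assms hull_inc[of 0 S convex] by (auto simp: conically_convex_def)
qed

lemma gen_cone_add:
  assumes "conically_convex S" "a \<in> gen_cone S" "b \<in> gen_cone S"
  shows "a + b \<in> gen_cone S"
proof -
  have "(1/2) *\<^sub>R a + (1/2) *\<^sub>R b \<in> gen_cone S"
    using assms by (intro convexD) (auto simp: conically_convex_def)
  then obtain t x where tx: "t > 0" "x \<in> S" "(1/2) *\<^sub>R a + (1/2) *\<^sub>R b = t *\<^sub>R x"
    by (auto simp: gen_cone_def)
  have "a + b = 2 *\<^sub>R ((1/2) *\<^sub>R a + (1/2) *\<^sub>R b)"
    by (simp add: scaleR_right_distrib)
  also have "\<dots> = (2 * t) *\<^sub>R x"
    using tx by simp
  finally show ?thesis
    using tx by (auto intro: gen_coneI)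
qed

lemma admissible_scaleR_nonzero:
  assumes "admissible D f" "u \<in> D" "t > 0"
  shows "t *\<^sub>R f u \<noteq> 0"
  using assms zero_notin_gen_cone[of "f ` D"] gen_coneI[of t "f u" "f ` D"]
  by (auto simp: admissible_def)

lemma admissible_same_ray_imp_eq:
  assumes "admissible D f" "u \<in> D" "v \<in> D" "s > 0" "t > 0" "s *\<^sub>R f u = t *\<^sub>R f v"
  shows "u = v"
proof -
  have "s *\<^sub>R f u \<in> ray (f u)" "s *\<^sub>R f u \<in> ray (f v)"
    unfolding ray_def using assms(4-6) by blast+
  then have "f u = f v"
    using assms(1-3) unfolding admissible_def observable_def by blast
  then show ?thesis
    using assms by (auto simp: admissible_def dest: inj_onD)
qed

text \<open>Two distinct values are linearly independent: a relation with coefficients of opposite sign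
  would make their rays meet, and one with coefficients of equal sign would put the origin into the
  cone.\<close>
lemma admissible_independent_pair:
  assumes f: "admissible D f" and uv: "u \<in> D" "v \<in> D" "u \<noteq> v"
    and eq: "a *\<^sub>R f u = b *\<^sub>R f v"
  shows "a = 0"
proof -
  have pos: False if "c > 0" "c *\<^sub>R f u = d *\<^sub>R f v" for c d
  proof (cases d "0 :: real" rule: linorder_cases)
    case less
    have "c *\<^sub>R f u + (- d) *\<^sub>R f v \<in> gen_cone (f ` D)"
      using f uv less that by (intro gen_cone_add gen_coneI) (auto simp: admissible_def)
    then show False
      using that f zero_notin_gen_cone[of "f ` D"] by (auto simp: admissible_def)
  next
    case equal
    then show False
      using that admissible_scaleR_nonzero[OF f uv(1)] by auto
  next
    case greater
    then show False
      using that admissible_same_ray_imp_eq[OF f uv(1,2)] uv(3) by blast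
  qed
  have "(- a) *\<^sub>R f u = (- b) *\<^sub>R f v"
    using eq by simp
  then show ?thesis
    using pos[of a b] pos[of "- a" "- b"] eq by (cases a "0 :: real" rule: linorder_cases) auto
qed

section \<open>Means as solutions of a ray equation\<close>

definition weighted_sum :: "('d \<Rightarrow> 'a::real_vector) \<Rightarrow> 'd list \<Rightarrow> real list \<Rightarrow> 'a" where
  "weighted_sum f x l = (\<Sum>k<length x. l ! k *\<^sub>R f (x ! k))"

lemma weighted_sum_Nil [simp]: "weighted_sum f [] l = 0"
  by (simp add: weighted_sum_def)

lemma weighted_sum_Cons [simp]:
  "weighted_sum f (a # x) (r # l) = r *\<^sub>R f a + weighted_sum f x l"
  by (simp add: weighted_sum_def sum.lessThan_Suc_shift del: sum.lessThan_Suc)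

lemma weighted_sum_map:
  assumes "distinct x"
  shows "weighted_sum f x (map c x) = (\<Sum>z\<in>set x. c z *\<^sub>R f z)"
  using assms by (induction x) auto

lemma weighted_sum_linear:
  assumes "linear A" "set x \<subseteq> D" "\<And>z. z \<in> D \<Longrightarrow> g z = A (f z)"
  shows "weighted_sum g x l = A (weighted_sum f x l)"
proof -
  have "l ! k *\<^sub>R g (x ! k) = A (l ! k *\<^sub>R f (x ! k))" if "k < length x" for k
    using assms(2,3) nth_mem[OF that] by (simp add: linear_scale[OF assms(1)] subset_iff)
  then show ?thesis
    by (simp add: weighted_sum_def linear_sum[OF assms(1)])
qed

lemma weighted_tuples_iff:
  "(x, l) \<in> weighted_tuples D \<longleftrightarrow>
    set x \<subseteq> D \<and> length l = length x \<and> (\<forall>t\<in>set l. t \<ge> 0) \<and> (\<exists>t\<in>set l. t \<noteq> 0)"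
proof -
  have nonzero: "l \<noteq> replicate (length l) 0 \<longleftrightarrow> (\<exists>t\<in>set l. t \<noteq> 0)"
    using replicate_length_same[of l 0] in_set_replicate[of _ "length l" 0] by metis
  have "(x, l) \<in> weighted_tuples D \<longleftrightarrow> length x \<ge> 1 \<and> set x \<subseteq> D \<and> length l = length x \<and>
    (\<forall>t\<in>set l. t \<ge> 0) \<and> l \<noteq> replicate (length l) 0"
    unfolding weighted_tuples_def weights_def by auto
  also have "\<dots> \<longleftrightarrow> set x \<subseteq> D \<and> length l = length x \<and> (\<forall>t\<in>set l. t \<ge> 0) \<and>
    l \<noteq> replicate (length l) 0"
    by (cases x) auto
  finally show ?thesis
    unfolding nonzero .
qed

lemma weighted_sum_in_gen_cone:
  assumes f: "admissible D f" and xl: "(x, l) \<in> weighted_tuples D"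
  shows "weighted_sum f x l \<in> gen_cone (f ` D)"
proof -
  have cc: "conically_convex (f ` D)"
    using f by (simp add: admissible_def)
  have "length x = length l" "set x \<subseteq> D" "\<forall>t\<in>set l. t \<ge> 0"
    using xl by (auto simp: weighted_tuples_iff)
  \<comment> \<open>The case of all-zero weights is kept in the induction since the tail of a tuple may have only those.\<close>
  then have "(if \<exists>t\<in>set l. t \<noteq> 0 then weighted_sum f x l \<in> gen_cone (f ` D)
    else weighted_sum f x l = 0)"
  proof (induction x l rule: list_induct2)
    case Nil
    then show ?case by simp
  next
    case (Cons a x r l)
    have "r *\<^sub>R f a \<in> gen_cone (f ` D)" if "r \<noteq> 0"
      using Cons.prems that by (intro gen_coneI) auto
    then show ?case
      using Cons gen_cone_add[OF cc] by (cases "r = 0") (auto split: if_splits)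
  qed
  then show ?thesis
    using xl by (auto simp: weighted_tuples_iff)
qed

lemma weighted_sum_on_ray:
  assumes "admissible D f" "(x, l) \<in> weighted_tuples D"
  obtains u t where "u \<in> D" "t > 0" "weighted_sum f x l = t *\<^sub>R f u"
  using weighted_sum_in_gen_cone[OF assms] by (auto simp: gen_cone_def)

lemma gen_inv_scaleR:
  assumes f: "admissible D f" and u: "u \<in> D" and t: "t > 0"
  shows "gen_inv D f (t *\<^sub>R f u) = u"
proof -
  have "ray_proj D f (t *\<^sub>R f u) = f u"
    unfolding ray_proj_def
  proof (rule the_equality)
    show "f u \<in> f ` D \<and> t *\<^sub>R f u \<in> ray (f u)"
      using u t by (auto simp: ray_def)
  next
    fix y assume "y \<in> f ` D \<and> t *\<^sub>R f u \<in> ray y"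
    then show "y = f u"
      using admissible_same_ray_imp_eq[OF f u _ t] by (auto simp: ray_def)
  qed
  then show ?thesis
    using f u by (simp add: gen_inv_def admissible_def)
qed

lemma baj_mean_eqI:
  assumes "admissible D f" "u \<in> D" "t > 0" "weighted_sum f x l = t *\<^sub>R f u"
  shows "baj_mean D f (x, l) = u"
  using gen_inv_scaleR[OF assms(1-3)] assms(4) by (simp add: baj_mean_def weighted_sum_def)

section \<open>Transfer of linear relations between functions with equal means\<close>

lemma equal_means_transfer_ray:
  assumes f: "admissible D f" and g: "admissible D g"
    and eq: "\<forall>p\<in>weighted_tuples D. baj_mean D f p = baj_mean D g p"
    and xl: "(x, l) \<in> weighted_tuples D"
    and u: "u \<in> D" "t > 0" "weighted_sum f x l = t *\<^sub>R f u"
  obtains s where "s > 0" "weighted_sum g x l = s *\<^sub>R g u"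
proof -
  obtain v s where v: "v \<in> D" "s > 0" "weighted_sum g x l = s *\<^sub>R g v"
    using weighted_sum_on_ray[OF g xl] .
  have "u = baj_mean D f (x, l)"
    using baj_mean_eqI[OF f u] by simp
  also have "\<dots> = v"
    using baj_mean_eqI[OF g v] eq xl by simp
  finally show ?thesis
    using v that by blast
qed

text \<open>Equal means force not only the ray but the scaling factor on it to agree. A tuple by itself
  reveals only the ray; the factor becomes visible when the tuple is averaged with a point \<open>v\<close> other
  than its mean, for then it decides the ray of the new mean. If \<open>D\<close> has no such point, both factors
  are the total weight.\<close>
lemma equal_means_transfer_point:
  assumes f: "admissible D f" and g: "admissible D g"
    and eq: "\<forall>p\<in>weighted_tuples D. baj_mean D f p = baj_mean D g p"
    and xl: "(x, l) \<in> weighted_tuples D"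
    and u: "u \<in> D" "t > 0" "weighted_sum f x l = t *\<^sub>R f u"
  shows "weighted_sum g x l = t *\<^sub>R g u"
proof (cases "D = {u}")
  case True
  have total: "weighted_sum h x l = (\<Sum>k<length x. l ! k) *\<^sub>R h u" for h :: "'a \<Rightarrow> 'e::real_vector"
  proof -
    have "x ! k = u" if "k < length x" for k
      using nth_mem[OF that] xl True by (auto simp: weighted_tuples_iff)
    then show ?thesis
      by (simp add: weighted_sum_def scaleR_left.sum)
  qed
  have "f u \<noteq> 0"
    using admissible_scaleR_nonzero[OF f u(1), of 1] by simp
  then have "(\<Sum>k<length x. l ! k) = t"
    using u(3) total[of f] by simp
  then show ?thesis
    using total[of g] by simp
next
  case False
  then obtain v where v: "v \<in> D" "v \<noteq> u"
    using u by blast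
  obtain s where s: "s > 0" "weighted_sum g x l = s *\<^sub>R g u"
    using equal_means_transfer_ray[OF f g eq xl u] .
  have pair: "([v, u], [1, t]) \<in> weighted_tuples D"
    using u v by (auto simp: weighted_tuples_iff)
  have longer: "(v # x, 1 # l) \<in> weighted_tuples D"
    using xl v by (auto simp: weighted_tuples_iff)
  obtain w r where w: "w \<in> D" "r > 0" "weighted_sum f [v, u] [1, t] = r *\<^sub>R f w"
    using weighted_sum_on_ray[OF f pair] .
  have w': "weighted_sum f (v # x) (1 # l) = r *\<^sub>R f w"
    using w u by simp
  obtain p where p: "p > 0" "weighted_sum g [v, u] [1, t] = p *\<^sub>R g w"
    using equal_means_transfer_ray[OF f g eq pair w] .
  obtain q where q: "q > 0" "weighted_sum g (v # x) (1 # l) = q *\<^sub>R g w"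
    using equal_means_transfer_ray[OF f g eq longer w(1,2) w'] .
  have "q *\<^sub>R (g v + t *\<^sub>R g u) = p *\<^sub>R (g v + s *\<^sub>R g u)"
    using p q s by (simp add: mult.commute)
  then have rel: "(q - p) *\<^sub>R g v = (p * s - q * t) *\<^sub>R g u"
    by (simp add: algebra_simps)
  have "q - p = 0"
    using admissible_independent_pair[OF g v(1) u(1) v(2) rel] .
  moreover have "p * s - q * t = 0"
    using admissible_independent_pair[OF g u(1) v(1) v(2)[symmetric] rel[symmetric]] .
  ultimately have "s = t"
    using p by simp
  then show ?thesis
    using s by simp
qed

text \<open>The positive and the negative part of the coefficients are two systems of weights with the
  same weighted sum \<open>t *\<^sub>R f u\<close>. Each of them transfers to \<open>g\<close>, with the same \<open>u\<close> and \<open>t\<close>.\<close>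
lemma equal_means_transfer_relation:
  assumes f: "admissible D f" and g: "admissible D g"
    and eq: "\<forall>p\<in>weighted_tuples D. baj_mean D f p = baj_mean D g p"
    and T: "finite T" "T \<subseteq> D" and rel: "(\<Sum>z\<in>T. c z *\<^sub>R f z) = 0"
  shows "(\<Sum>z\<in>T. c z *\<^sub>R g z) = 0"
proof (cases "\<forall>z\<in>T. c z = 0")
  case True
  then show ?thesis by simp
next
  case False
  obtain x where x: "set x = T" "distinct x"
    using finite_distinct_list[OF T(1)] by blast
  define P where "P = map (\<lambda>z. max (c z) 0) x"
  define N where "N = map (\<lambda>z. max (- c z) 0) x"
  have parts: "weighted_sum h x P - weighted_sum h x N = (\<Sum>z\<in>T. c z *\<^sub>R h z)"
    for h :: "'a \<Rightarrow> 'e::real_vector"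
    unfolding P_def N_def weighted_sum_map[OF x(2)] x(1) sum_subtractf[symmetric]
    by (intro sum.cong) (auto simp: max_def)
  have fPN: "weighted_sum f x P = weighted_sum f x N"
    using parts[of f] rel by simp
  have tuple_iff: "(x, map d x) \<in> weighted_tuples D \<longleftrightarrow> (\<exists>z\<in>T. d z \<noteq> 0)"
    if "\<And>z. d z \<ge> 0" for d
    using x T that by (auto simp: weighted_tuples_iff)
  have P_iff: "(x, P) \<in> weighted_tuples D \<longleftrightarrow> (\<exists>z\<in>T. c z > 0)"
    unfolding P_def by (subst tuple_iff) (auto simp: max_def not_le)
  have N_iff: "(x, N) \<in> weighted_tuples D \<longleftrightarrow> (\<exists>z\<in>T. c z < 0)"
    unfolding N_def by (subst tuple_iff) (auto simp: max_def not_le)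
  have P0: "weighted_sum f x P = 0" if "(x, P) \<notin> weighted_tuples D"
    using that P_iff unfolding P_def weighted_sum_map[OF x(2)] x(1)
    by (intro sum.neutral) (auto simp: max_def)
  have N0: "weighted_sum f x N = 0" if "(x, N) \<notin> weighted_tuples D"
    using that N_iff unfolding N_def weighted_sum_map[OF x(2)] x(1)
    by (intro sum.neutral) (auto simp: max_def)
  have nz: "weighted_sum f x l \<noteq> 0" if "(x, l) \<in> weighted_tuples D" for l
    using weighted_sum_in_gen_cone[OF f that] zero_notin_gen_cone[of "f ` D"] f
    by (auto simp: admissible_def)
  have "(x, P) \<in> weighted_tuples D \<or> (x, N) \<in> weighted_tuples D"
    using False P_iff N_iff by (meson linorder_neqE)
  \<comment> \<open>A relation with coefficients of one sign only is excluded, as the origin is not in the cone.\<close>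
  then have tuples: "(x, P) \<in> weighted_tuples D" "(x, N) \<in> weighted_tuples D"
    using P0 N0 nz fPN by metis+
  obtain u t where u: "u \<in> D" "t > 0" "weighted_sum f x P = t *\<^sub>R f u"
    using weighted_sum_on_ray[OF f tuples(1)] .
  have "weighted_sum g x P = t *\<^sub>R g u"
    using equal_means_transfer_point[OF f g eq tuples(1) u] .
  moreover have "weighted_sum g x N = t *\<^sub>R g u"
    using equal_means_transfer_point[OF f g eq tuples(2) u(1,2)] u(3) fPN by simp
  ultimately show ?thesis
    using parts[of g] by simp
qed

section \<open>Linear factorization\<close>

lemma linear_factorization_if_relations_transfer:
  fixes f :: "'d \<Rightarrow> 'x::real_vector" and g :: "'d \<Rightarrow> 'y::real_vector"
  assumes inj: "inj_on f D"
    and transfer: "\<And>T c. finite T \<Longrightarrow> T \<subseteq> D \<Longrightarrow> (\<Sum>z\<in>T. c z *\<^sub>R f z) = 0 \<Longrightarrow>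
      (\<Sum>z\<in>T. c z *\<^sub>R g z) = 0"
  obtains A where "linear A" "\<And>x. x \<in> D \<Longrightarrow> g x = A (f x)"
proof -
  obtain B where B: "B \<subseteq> f ` D" "independent B" "f ` D \<subseteq> span B"
    using maximal_independent_subset[of "f ` D"] by blast
  obtain A where A: "linear A" "\<And>b. b \<in> B \<Longrightarrow> A b = g (inv_into D f b)"
    using linear_independent_extend[OF B(2), of "\<lambda>b. g (inv_into D f b)"] by blast
  have A_f: "A (f z) = g z" if "z \<in> D" "f z \<in> B" for z
    using A(2)[OF that(2)] inj that(1) by simp
  have "g x = A (f x)" if x: "x \<in> D" for x
  proof (cases "f x \<in> B")
    case True
    then show ?thesis
      using A_f x by simp
  next
    case False
    have "f x \<in> span B"
      using B(3) x by blast
    then obtain S r where S: "finite S" "S \<subseteq> B" "f x = (\<Sum>b\<in>S. r b *\<^sub>R b)"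
      by (auto simp: span_explicit)
    define E where "E = inv_into D f ` S"
    have fE: "f ` E = S" and E: "finite E" "E \<subseteq> D"
      using S B(1) unfolding E_def image_image
      by (auto simp: f_inv_into_f inv_into_into subset_iff image_iff)
    have "x \<notin> E"
      using False S(2) fE by blast
    have injE: "inj_on f E"
      using inj E(2) by (rule inj_on_subset)
    have fx: "f x = (\<Sum>z\<in>E. r (f z) *\<^sub>R f z)"
      using S(3) unfolding fE[symmetric] sum.reindex[OF injE] by simp
    \<comment> \<open>The expansion of \<open>f x\<close> in the basis, read as a linear relation on \<open>insert x E\<close>.\<close>
    define c where "c z = (if z = x then - 1 else r (f z))" for z
    have split: "(\<Sum>z\<in>insert x E. c z *\<^sub>R h z) = (\<Sum>z\<in>E. r (f z) *\<^sub>R h z) - h x"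
      for h :: "'d \<Rightarrow> 'e::real_vector"
    proof -
      have "(\<Sum>z\<in>E. c z *\<^sub>R h z) = (\<Sum>z\<in>E. r (f z) *\<^sub>R h z)"
        using \<open>x \<notin> E\<close> by (intro sum.cong) (auto simp: c_def)
      then show ?thesis
        using E \<open>x \<notin> E\<close> by (simp add: c_def)
    qed
    have "(\<Sum>z\<in>insert x E. c z *\<^sub>R g z) = 0"
      using E x split[of f] fx by (intro transfer) auto
    then have "g x = (\<Sum>z\<in>E. r (f z) *\<^sub>R g z)"
      using split[of g] by simp
    also have "\<dots> = (\<Sum>z\<in>E. A (r (f z) *\<^sub>R f z))"
      using A_f E(2) fE S(2) by (intro sum.cong) (auto simp: linear_scale[OF A(1)] subset_iff)
    also have "\<dots> = A (f x)"
      unfolding fx by (simp add: linear_sum[OF A(1)])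
    finally show ?thesis .
  qed
  then show ?thesis
    using that A(1) by blast
qed

theorem theorem6p1:
  fixes D :: "'d set"
    and f :: "'d \<Rightarrow> 'x::real_vector"
    and g :: "'d \<Rightarrow> 'y::real_vector"
  assumes "admissible D f" and "admissible D g"
  shows "(\<forall>p\<in>weighted_tuples D. baj_mean D f p = baj_mean D g p) \<longleftrightarrow>
         (\<exists>A :: 'x \<Rightarrow> 'y. linear A \<and> (\<forall>x\<in>D. g x = (A \<circ> f) x))"
proof
  assume eq: "\<forall>p\<in>weighted_tuples D. baj_mean D f p = baj_mean D g p"
  have "inj_on f D"
    using assms(1) by (simp add: admissible_def)
  then obtain A where "linear A" "\<And>x. x \<in> D \<Longrightarrow> g x = A (f x)"
    using linear_factorization_if_relations_transfer[of f D g]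
      equal_means_transfer_relation[OF assms eq] by blast
  then show "\<exists>A :: 'x \<Rightarrow> 'y. linear A \<and> (\<forall>x\<in>D. g x = (A \<circ> f) x)"
    by auto
next
  assume "\<exists>A :: 'x \<Rightarrow> 'y. linear A \<and> (\<forall>x\<in>D. g x = (A \<circ> f) x)"
  then obtain A where A: "linear A" "\<And>x. x \<in> D \<Longrightarrow> g x = A (f x)"
    by auto
  show "\<forall>p\<in>weighted_tuples D. baj_mean D f p = baj_mean D g p"
  proof (clarify)
    fix x l assume xl: "(x, l) \<in> weighted_tuples D"
    obtain u t where u: "u \<in> D" "t > 0" "weighted_sum f x l = t *\<^sub>R f u"
      using weighted_sum_on_ray[OF assms(1) xl] .
    have "weighted_sum g x l = A (weighted_sum f x l)"
      using xl A by (intro weighted_sum_linear[where D = D]) (auto simp: weighted_tuples_iff)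
    also have "\<dots> = t *\<^sub>R g u"
      using u A by (simp add: linear_scale)
    finally show "baj_mean D f (x, l) = baj_mean D g (x, l)"
      using baj_mean_eqI[OF assms(1) u] baj_mean_eqI[OF assms(2) u(1,2)] by simp
  qed
qed

end
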